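(* In persuasion games with evidence (with binary utilities as defined in the context), the price of anarchy for the receiver is $2$ and this is tight; that is, in every instance the receiver's price of anarchy is at most $2$, and there is an instance in which it equals $2$. The price of anarchy and the price of stability for the sender are both unbounded.
   Context: An instance consists of a finite set $\Theta$ of states partitioned as $\Theta=\Theta_A\sqcup\Theta_R$ (acceptable and rejectable states), a finite set $\Sigma$ of signals, probabilities $q_\theta>0$ with $\sum_\theta q_\theta=1$, and a bipartite graph $H=(\Theta\cup\Sigma,E)$, $E\subseteq\Theta\times\Sigma$, without isolated vertices; $(\theta,\sigma)\in E$ means that $\sigma$ may be sent in $\theta$, and $N(\cdot)$ denotes neighborhoods. The receiver chooses action $A$ or $R$. The sender has utility $u_s(A,\theta)=1$, $u_s(R,\theta)=0$ for all $\theta$. The receiver has utility $u_r(a,\theta)=1$ if ($a=A$ and $\theta\in\Theta_A$) or ($a=R$ and $\theta\in\Theta_R$), and $0$ otherwise. A signaling scheme is $\varphi:E\to[0,1]$ with $\sum_{\sigma\in N(\theta)}\varphi(\theta,\sigma)=q_\theta$ for all $\theta$. A decision scheme is $\psi:\Sigma\to[0,1]$, where $\psi(\sigma)$ is the probability of action $A$ on signal $\sigma$. Expected utilities are $U_x(\varphi,\psi)=\sum_{(\theta,\sigma)\in E}\varphi(\theta,\sigma)[\psi(\sigma)u_x(A,\theta)+(1-\psi(\sigma))u_x(R,\theta)]$ for $x\in\{s,r\}$. A pair $(\varphi,\psi)$ is a Bayes-Nash equilibrium if $\varphi$ maximizes $U_s(\cdot,\psi)$ and $\psi$ maximizes $U_r(\varphi,\cdot)$.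 Optimal utility with commitment. For the receiver: the maximum over decision schemes $\psi$ of the receiver's utility when the sender best-responds to $\psi$ (in each state $\theta$ she sends a signal of $N(\theta)$ maximizing $\psi$). For the sender: the maximum over signaling schemes $\varphi$ of the sender's utility when the receiver best-responds to $\varphi$, with ties broken in favor of $A$. For each player, the price of anarchy (respectively, price of stability) of an instance is the ratio of the player's optimal utility with commitment to the player's worst (respectively, best) utility in any Bayes-Nash equilibrium; a positive number divided by $0$ is $+\infty$. "Unbounded" means that for every $C>0$ there is an instance in which the ratio exceeds $C$. *)

theory Defs
  imports "HOL-Library.FuncSet" "HOL-Library.Extended_Real"
begin

datatype player = Sender | Receiver

datatype action = Accept | Reject

record ('s, 'm) evidence_game =
  acceptable :: "'s set"
  rejectable :: "'s set"
  signals :: "'m set"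
  prior :: "'s \<Rightarrow> real"
  edges :: "('s \<times> 'm) set"

definition states :: "('s, 'm) evidence_game \<Rightarrow> 's set" where
  "states G = acceptable G \<union> rejectable G"

definition nbrs :: "('s, 'm) evidence_game \<Rightarrow> 's \<Rightarrow> 'm set" where
  "nbrs G \<theta> = {\<sigma>. (\<theta>, \<sigma>) \<in> edges G}"

definition evidence_game :: "('s, 'm) evidence_game \<Rightarrow> bool" where
  "evidence_game G \<longleftrightarrow>
     finite (states G) \<and> acceptable G \<inter> rejectable G = {} \<and> finite (signals G) \<and>
     (\<forall>\<theta>\<in>states G. prior G \<theta> > 0) \<and> (\<Sum>\<theta>\<in>states G. prior G \<theta>) = 1 \<and>
     edges G \<subseteq> states G \<times> signals G \<and>
     (\<forall>\<theta>\<in>states G. \<exists>\<sigma>. (\<theta>, \<sigma>) \<in> edges G) \<and>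
     (\<forall>\<sigma>\<in>signals G. \<exists>\<theta>. (\<theta>, \<sigma>) \<in> edges G)"

text \<open>Schemes are total HOL functions; only their values on the edges, respectively on the
  signals, are constrained, and no other values enter the expected utilities.\<close>

definition signaling_schemes :: "('s, 'm) evidence_game \<Rightarrow> ('s \<times> 'm \<Rightarrow> real) set" where
  "signaling_schemes G =
     {\<phi> \<in> edges G \<rightarrow> {0..1}. \<forall>\<theta>\<in>states G. (\<Sum>\<sigma>\<in>nbrs G \<theta>. \<phi> (\<theta>, \<sigma>)) = prior G \<theta>}"

definition decision_schemes :: "('s, 'm) evidence_game \<Rightarrow> ('m \<Rightarrow> real) set" where
  "decision_schemes G = signals G \<rightarrow> {0..1}"

fun utility :: "('s, 'm) evidence_game \<Rightarrow> player \<Rightarrow> action \<Rightarrow> 's \<Rightarrow> real" where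
  "utility G Sender Accept \<theta> = 1"
| "utility G Sender Reject \<theta> = 0"
| "utility G Receiver Accept \<theta> = (if \<theta> \<in> acceptable G then 1 else 0)"
| "utility G Receiver Reject \<theta> = (if \<theta> \<in> rejectable G then 1 else 0)"

definition expected_utility ::
    "('s, 'm) evidence_game \<Rightarrow> player \<Rightarrow> ('s \<times> 'm \<Rightarrow> real) \<Rightarrow> ('m \<Rightarrow> real) \<Rightarrow> real" where
  "expected_utility G x \<phi> \<psi> =
     (\<Sum>(\<theta>, \<sigma>)\<in>edges G.
        \<phi> (\<theta>, \<sigma>) * (\<psi> \<sigma> * utility G x Accept \<theta> + (1 - \<psi> \<sigma>) * utility G x Reject \<theta>))"

definition sender_best_responses ::
    "('s, 'm) evidence_game \<Rightarrow> ('m \<Rightarrow> real) \<Rightarrow> ('s \<times> 'm \<Rightarrow> real) set" where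
  "sender_best_responses G \<psi> =
     {\<phi> \<in> signaling_schemes G. \<forall>\<phi>'\<in>signaling_schemes G.
        expected_utility G Sender \<phi>' \<psi> \<le> expected_utility G Sender \<phi> \<psi>}"

definition receiver_best_responses ::
    "('s, 'm) evidence_game \<Rightarrow> ('s \<times> 'm \<Rightarrow> real) \<Rightarrow> ('m \<Rightarrow> real) set" where
  "receiver_best_responses G \<phi> =
     {\<psi> \<in> decision_schemes G. \<forall>\<psi>'\<in>decision_schemes G.
        expected_utility G Receiver \<phi> \<psi>' \<le> expected_utility G Receiver \<phi> \<psi>}"

text \<open>Since the receiver's problem separates over signals, breaking ties in favor of acceptance
  at every signal means playing the pointwise greatest best response.\<close>

definition accepting_best_responses ::
    "('s, 'm) evidence_game \<Rightarrow> ('s \<times> 'm \<Rightarrow> real) \<Rightarrow> ('m \<Rightarrow> real) set" where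
  "accepting_best_responses G \<phi> =
     {\<psi> \<in> receiver_best_responses G \<phi>. \<forall>\<psi>'\<in>receiver_best_responses G \<phi>.
        \<forall>\<sigma>\<in>signals G. \<psi>' \<sigma> \<le> \<psi> \<sigma>}"

definition equilibria ::
    "('s, 'm) evidence_game \<Rightarrow> (('s \<times> 'm \<Rightarrow> real) \<times> ('m \<Rightarrow> real)) set" where
  "equilibria G =
     {(\<phi>, \<psi>). \<phi> \<in> sender_best_responses G \<psi> \<and> \<psi> \<in> receiver_best_responses G \<phi>}"

text \<open>The strategy pairs that can result when the given player commits first. For a committed
  receiver no tie-breaking rule is needed: all best responses of the sender to a given decision
  scheme induce the same acceptance probability in every state, hence the same utilities.\<close>

fun commitment_profiles ::
    "('s, 'm) evidence_game \<Rightarrow> player \<Rightarrow> (('s \<times> 'm \<Rightarrow> real) \<times> ('m \<Rightarrow> real)) set" where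
  "commitment_profiles G Receiver =
     {(\<phi>, \<psi>). \<psi> \<in> decision_schemes G \<and> \<phi> \<in> sender_best_responses G \<psi>}"
| "commitment_profiles G Sender =
     {(\<phi>, \<psi>). \<phi> \<in> signaling_schemes G \<and> \<psi> \<in> accepting_best_responses G \<phi>}"

text \<open>In every evidence game the following suprema and infima range over nonempty bounded sets
  of reals and are attained. They are taken in the extended reals so that the ratios below can be
  infinite: there, a positive number divided by \<open>0\<close> is \<open>\<infinity>\<close>, whereas \<open>0 / 0 = 0\<close>, so that an
  instance in which the sender can never obtain anything does not count as having a large price.\<close>

definition commitment_utility :: "('s, 'm) evidence_game \<Rightarrow> player \<Rightarrow> ereal" where
  "commitment_utility G x =
     (SUP (\<phi>, \<psi>)\<in>commitment_profiles G x. ereal (expected_utility G x \<phi> \<psi>))"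

definition worst_equilibrium_utility :: "('s, 'm) evidence_game \<Rightarrow> player \<Rightarrow> ereal" where
  "worst_equilibrium_utility G x =
     (INF (\<phi>, \<psi>)\<in>equilibria G. ereal (expected_utility G x \<phi> \<psi>))"

definition best_equilibrium_utility :: "('s, 'm) evidence_game \<Rightarrow> player \<Rightarrow> ereal" where
  "best_equilibrium_utility G x =
     (SUP (\<phi>, \<psi>)\<in>equilibria G. ereal (expected_utility G x \<phi> \<psi>))"

definition price_of_anarchy :: "('s, 'm) evidence_game \<Rightarrow> player \<Rightarrow> ereal" where
  "price_of_anarchy G x = commitment_utility G x / worst_equilibrium_utility G x"

definition price_of_stability :: "('s, 'm) evidence_game \<Rightarrow> player \<Rightarrow> ereal" where
  "price_of_stability G x = commitment_utility G x / best_equilibrium_utility G x"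

end

theory Submission
  imports Defs
begin

text \<open>The receiver never gets more than \<open>1\<close>, and in equilibrium she gets at least what the constant
  decision schemes give her, that is, at least the larger one of the prior probabilities of
  \<open>\<Theta>\<^sub>A\<close> and \<open>\<Theta>\<^sub>R\<close>, which is at least \<open>1/2\<close>. This is tight when two equally likely states can
  be separated, but the sender pools them because the receiver rejects every signal.

  For the sender, let an acceptable state be able to send only one signal, which a more likely
  rejectable state may imitate or avoid. Sending the pooling signal just rarely enough in the
  rejectable state gets that signal accepted, but without commitment the sender cannot refrain from
  always sending an accepted signal. Hence no equilibrium has acceptance at all, and both sender
  prices of this single instance are infinite.\<close>

section \<open>Bounds on the receiver's utility\<close>

text \<open>Grouping the edges by state, the mass sent from each state adds up to its prior. So a
  payoff that depends on the state alone has the same expectation under all signaling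
  schemes.\<close>

lemma sum_edges_prior:
  assumes "evidence_game G" and "\<phi> \<in> signaling_schemes G"
  shows "(\<Sum>(\<theta>, \<sigma>)\<in>edges G. \<phi> (\<theta>, \<sigma>) * f \<theta>) = (\<Sum>\<theta>\<in>states G. prior G \<theta> * f \<theta>)"
proof -
  have sub: "edges G \<subseteq> states G \<times> signals G" and fin: "finite (states G)" "finite (signals G)"
    using assms(1) by (auto simp: evidence_game_def)
  have eq: "edges G = (SIGMA \<theta>:states G. nbrs G \<theta>)"
    using sub by (auto simp: nbrs_def)
  have finN: "finite (nbrs G \<theta>)" for \<theta>
    using sub by (intro finite_subset[OF _ fin(2)]) (auto simp: nbrs_def)
  have "(\<Sum>(\<theta>, \<sigma>)\<in>edges G. \<phi> (\<theta>, \<sigma>) * f \<theta>)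
      = (\<Sum>\<theta>\<in>states G. \<Sum>\<sigma>\<in>nbrs G \<theta>. \<phi> (\<theta>, \<sigma>) * f \<theta>)"
    unfolding eq using fin finN by (subst sum.Sigma) auto
  also have "\<dots> = (\<Sum>\<theta>\<in>states G. prior G \<theta> * f \<theta>)"
    using assms(2) by (simp add: signaling_schemes_def flip: sum_distrib_right)
  finally show ?thesis .
qed

lemma receiver_utility_le_1:
  assumes G: "evidence_game G" and \<phi>: "\<phi> \<in> signaling_schemes G" and \<psi>: "\<psi> \<in> decision_schemes G"
  shows "expected_utility G Receiver \<phi> \<psi> \<le> 1"
proof -
  have "expected_utility G Receiver \<phi> \<psi> \<le> (\<Sum>(\<theta>, \<sigma>)\<in>edges G. \<phi> (\<theta>, \<sigma>) * 1)"
    unfolding expected_utility_def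
  proof (intro sum_mono, clarify)
    fix \<theta> \<sigma> assume e: "(\<theta>, \<sigma>) \<in> edges G"
    then have "\<sigma> \<in> signals G" "\<not> (\<theta> \<in> acceptable G \<and> \<theta> \<in> rejectable G)"
      using G by (auto simp: evidence_game_def)
    moreover have "0 \<le> \<phi> (\<theta>, \<sigma>)"
      using e \<phi> by (auto simp: signaling_schemes_def Pi_iff)
    moreover have "0 \<le> \<psi> \<sigma>" "\<psi> \<sigma> \<le> 1"
      using \<psi> \<open>\<sigma> \<in> signals G\<close> by (auto simp: decision_schemes_def Pi_iff)
    ultimately show "\<phi> (\<theta>, \<sigma>) * (\<psi> \<sigma> * utility G Receiver Accept \<theta>
        + (1 - \<psi> \<sigma>) * utility G Receiver Reject \<theta>) \<le> \<phi> (\<theta>, \<sigma>) * 1"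
      by (intro mult_left_mono) auto
  qed
  also have "\<dots> = 1"
    using G sum_edges_prior[OF G \<phi>, of "\<lambda>_. 1"] by (simp add: evidence_game_def)
  finally show ?thesis .
qed

text \<open>In each state exactly one action is right, so always accepting and always rejecting give
  utilities that add up to 1. A best response does at least as well as the better of the
  two.\<close>

lemma receiver_best_response_ge_half:
  assumes G: "evidence_game G" and \<phi>: "\<phi> \<in> signaling_schemes G"
    and \<psi>: "\<psi> \<in> receiver_best_responses G \<phi>"
  shows "1 / 2 \<le> expected_utility G Receiver \<phi> \<psi>"
proof -
  define acc where "acc \<theta> = utility G Receiver Accept \<theta>" for \<theta>
  define rej where "rej \<theta> = utility G Receiver Reject \<theta>" for \<theta>
  have "expected_utility G Receiver \<phi> (\<lambda>_. 1) = (\<Sum>\<theta>\<in>states G. prior G \<theta> * acc \<theta>)"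
    using sum_edges_prior[OF G \<phi>, of acc] by (simp add: expected_utility_def acc_def)
  moreover have "expected_utility G Receiver \<phi> (\<lambda>_. 0) = (\<Sum>\<theta>\<in>states G. prior G \<theta> * rej \<theta>)"
    using sum_edges_prior[OF G \<phi>, of rej] by (simp add: expected_utility_def rej_def)
  moreover have "(\<Sum>\<theta>\<in>states G. prior G \<theta> * acc \<theta>) + (\<Sum>\<theta>\<in>states G. prior G \<theta> * rej \<theta>)
      = (\<Sum>\<theta>\<in>states G. prior G \<theta>)"
    unfolding sum.distrib[symmetric]
    using G by (intro sum.cong) (auto simp: acc_def rej_def states_def evidence_game_def)
  moreover have "(\<Sum>\<theta>\<in>states G. prior G \<theta>) = 1"
    using G by (simp add: evidence_game_def)
  moreover have "(\<lambda>_. 1) \<in> decision_schemes G" "(\<lambda>_. 0) \<in> decision_schemes G"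
    by (auto simp: decision_schemes_def)
  then have "expected_utility G Receiver \<phi> (\<lambda>_. 1) \<le> expected_utility G Receiver \<phi> \<psi>"
    "expected_utility G Receiver \<phi> (\<lambda>_. 0) \<le> expected_utility G Receiver \<phi> \<psi>"
    using \<psi> by (auto simp: receiver_best_responses_def)
  ultimately show ?thesis by linarith
qed

lemma commitment_utility_Receiver_le_1:
  "evidence_game G \<Longrightarrow> commitment_utility G Receiver \<le> 1"
  unfolding commitment_utility_def
  by (intro SUP_least) (auto simp: sender_best_responses_def intro: receiver_utility_le_1)

lemma worst_equilibrium_utility_Receiver_ge_half:
  assumes "evidence_game G"
  shows "ereal (1 / 2) \<le> worst_equilibrium_utility G Receiver"
  unfolding worst_equilibrium_utility_def
proof (intro INF_greatest, clarify)
  fix \<phi> \<psi> assume "(\<phi>, \<psi>) \<in> equilibria G"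
  then show "ereal (1 / 2) \<le> ereal (expected_utility G Receiver \<phi> \<psi>)"
    using receiver_best_response_ge_half[OF assms, of \<phi> \<psi>]
    by (simp add: equilibria_def sender_best_responses_def)
qed

theorem price_of_anarchy_Receiver_le_2:
  assumes "evidence_game G"
  shows "price_of_anarchy G Receiver \<le> 2"
proof -
  let ?c = "commitment_utility G Receiver" and ?w = "worst_equilibrium_utility G Receiver"
  have c: "?c \<le> 1" and w: "ereal (1 / 2) \<le> ?w"
    using assms by (rule commitment_utility_Receiver_le_1 worst_equilibrium_utility_Receiver_ge_half)+
  show ?thesis
  proof (cases "?w = \<infinity>")
    \<comment> \<open>The infimum is infinite only if there are no equilibria; the ratio is then 0,
      so existence of equilibria need not be shown here.\<close>
    case True
    then show ?thesis by (simp add: price_of_anarchy_def)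
  next
    case False
    then obtain r where r: "?w = ereal r" "1 / 2 \<le> r"
      using w by (cases ?w) auto
    have "1 \<le> ereal r * 2"
      using r(2) unfolding one_ereal_def numeral_eq_ereal by simp
    then have "?c \<le> ereal r * 2"
      using c by (rule order_trans[rotated])
    then show ?thesis
      unfolding price_of_anarchy_def r(1) using r(2)
      by (intro ereal_divide_le_pos[THEN iffD2]) auto
  qed
qed

section \<open>An instance attaining the ratio 2\<close>

text \<open>Signal 1 is evidence that only the acceptable state 0 can produce; signal 0 allows
  pooling.\<close>

definition separable_game :: "(nat, nat) evidence_game" where
  "separable_game = \<lparr>acceptable = {0}, rejectable = {1}, signals = {0, 1},
     prior = (\<lambda>_. 1 / 2), edges = {(0, 0), (0, 1), (1, 0)}\<rparr>"

lemma separable_game_simps [simp]: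
  "acceptable separable_game = {0}" "rejectable separable_game = {1}"
  "signals separable_game = {0, 1}" "prior separable_game = (\<lambda>_. 1 / 2)"
  "edges separable_game = {(0, 0), (0, 1), (1, 0)}" "states separable_game = {0, 1}"
  "nbrs separable_game 0 = {0, 1}" "nbrs separable_game (Suc 0) = {0}"
  by (auto simp: separable_game_def states_def nbrs_def)

lemma evidence_game_separable: "evidence_game separable_game"
  by (auto simp: evidence_game_def)

lemma price_of_anarchy_separable: "price_of_anarchy separable_game Receiver = 2"
proof -
  define pool :: "nat \<times> nat \<Rightarrow> real" where "pool = (\<lambda>(\<theta>, \<sigma>). if \<sigma> = 0 then 1 / 2 else 0)"
  define sep :: "nat \<times> nat \<Rightarrow> real" where "sep = (\<lambda>(\<theta>, \<sigma>). if \<theta> = \<sigma> then 0 else 1 / 2)"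
  define \<psi> :: "nat \<Rightarrow> real" where "\<psi> \<sigma> = of_nat \<sigma>" for \<sigma>
  \<comment> \<open>Accepting exactly on signal 1 makes state 0 send it, which state 1 cannot do, so
    the receiver always decides correctly.\<close>
  have "(sep, \<psi>) \<in> commitment_profiles separable_game Receiver"
    by (auto simp: sender_best_responses_def signaling_schemes_def decision_schemes_def
        expected_utility_def sep_def \<psi>_def)
  moreover have "expected_utility separable_game Receiver sep \<psi> = 1"
    by (simp add: expected_utility_def sep_def \<psi>_def)
  ultimately have "1 \<le> commitment_utility separable_game Receiver"
    unfolding commitment_utility_def by (intro SUP_upper2[of "(sep, \<psi>)"]) auto
  then have c: "commitment_utility separable_game Receiver = 1"
    using commitment_utility_Receiver_le_1[OF evidence_game_separable] by order
  \<comment> \<open>The sender is indifferent because everything is rejected. The receiver is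
    indifferent on signal 0, where both states have mass 1/2, and signal 1 is never sent.\<close>
  have "(pool, \<lambda>_. 0) \<in> equilibria separable_game"
    by (auto simp: equilibria_def sender_best_responses_def receiver_best_responses_def
        signaling_schemes_def decision_schemes_def expected_utility_def pool_def field_simps)
  moreover have "expected_utility separable_game Receiver pool (\<lambda>_. 0) = 1 / 2"
    by (simp add: expected_utility_def pool_def)
  ultimately have "worst_equilibrium_utility separable_game Receiver \<le> ereal (1 / 2)"
    unfolding worst_equilibrium_utility_def by (intro INF_lower2[of "(pool, \<lambda>_. 0)"]) auto
  then have w: "worst_equilibrium_utility separable_game Receiver = ereal (1 / 2)"
    using worst_equilibrium_utility_Receiver_ge_half[OF evidence_game_separable] by order
  show ?thesis
    unfolding price_of_anarchy_def c w by (simp add: one_ereal_def)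
qed

section \<open>An instance with infinite prices for the sender\<close>

text \<open>Signal 0 imitates the acceptable state, signal 1 reveals the rejectable one. Accepting
  signal 0 is optimal exactly if the imitating mass is at most 1/4, whereas full imitation has mass
  3/4.\<close>

definition imitation_game :: "(nat, nat) evidence_game" where
  "imitation_game = \<lparr>acceptable = {0}, rejectable = {1}, signals = {0, 1},
     prior = (\<lambda>\<theta>. if \<theta> = 0 then 1 / 4 else 3 / 4), edges = {(0, 0), (1, 0), (1, 1)}\<rparr>"

lemma imitation_game_simps [simp]:
  "acceptable imitation_game = {0}" "rejectable imitation_game = {1}"
  "signals imitation_game = {0, 1}"
  "prior imitation_game = (\<lambda>\<theta>. if \<theta> = 0 then 1 / 4 else 3 / 4)"
  "edges imitation_game = {(0, 0), (1, 0), (1, 1)}" "states imitation_game = {0, 1}"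
  "nbrs imitation_game 0 = {0}" "nbrs imitation_game (Suc 0) = {0, 1}"
  by (auto simp: imitation_game_def states_def nbrs_def)

lemma evidence_game_imitation: "evidence_game imitation_game"
  by (auto simp: evidence_game_def)

lemma imitation_sender_utility:
  "expected_utility imitation_game Sender \<phi> \<psi> = \<phi> (0, 0) * \<psi> 0 + \<phi> (1, 0) * \<psi> 0 + \<phi> (1, 1) * \<psi> 1"
  by (simp add: expected_utility_def)

lemma imitation_receiver_utility:
  "expected_utility imitation_game Receiver \<phi> \<psi>
    = \<phi> (0, 0) * \<psi> 0 + \<phi> (1, 0) * (1 - \<psi> 0) + \<phi> (1, 1) * (1 - \<psi> 1)"
  by (simp add: expected_utility_def)

lemma imitation_signaling_schemes:
  "\<phi> \<in> signaling_schemes imitation_game \<longleftrightarrow>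
    \<phi> (0, 0) = 1 / 4 \<and> 0 \<le> \<phi> (1, 0) \<and> 0 \<le> \<phi> (1, 1) \<and> \<phi> (1, 0) + \<phi> (1, 1) = 3 / 4"
  by (auto simp: signaling_schemes_def)

lemma imitation_decision_schemes:
  "\<psi> \<in> decision_schemes imitation_game \<longleftrightarrow> \<psi> 0 \<in> {0..1} \<and> \<psi> 1 \<in> {0..1}"
  by (auto simp: decision_schemes_def)

text \<open>Signal 1 reveals the rejectable state, so no mass on it is accepted. If signal 0 were
  accepted with positive probability, the sender would imitate fully, and then rejecting signal 0
  would be strictly better.\<close>

lemma imitation_equilibrium_utility:
  assumes "(\<phi>, \<psi>) \<in> equilibria imitation_game"
  shows "expected_utility imitation_game Sender \<phi> \<psi> = 0"
proof -
  define x where "x = \<phi> (1, 0)"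
  have \<phi>: "\<phi> \<in> signaling_schemes imitation_game" and \<psi>: "\<psi> \<in> decision_schemes imitation_game"
    and bs: "\<And>\<phi>'. \<phi>' \<in> signaling_schemes imitation_game \<Longrightarrow>
      expected_utility imitation_game Sender \<phi>' \<psi> \<le> expected_utility imitation_game Sender \<phi> \<psi>"
    and br: "\<And>\<psi>'. \<psi>' \<in> decision_schemes imitation_game \<Longrightarrow>
      expected_utility imitation_game Receiver \<phi> \<psi>' \<le> expected_utility imitation_game Receiver \<phi> \<psi>"
    using assms
    by (auto simp: equilibria_def sender_best_responses_def receiver_best_responses_def)
  have x: "\<phi> (0, 0) = 1 / 4" "\<phi> (1, 0) = x" "\<phi> (1, 1) = 3 / 4 - x" "0 \<le> x" "x \<le> 3 / 4"
    using \<phi> by (auto simp: imitation_signaling_schemes x_def)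
  have p: "0 \<le> \<psi> 0" "0 \<le> \<psi> 1"
    using \<psi> by (auto simp: imitation_decision_schemes)
  \<comment> \<open>The left side is what the receiver gains by switching to rejection on signal
    1.\<close>
  have "(3 / 4 - x) * \<psi> 1 \<le> 0"
    using br[of "\<psi>(1 := 0)"] \<psi>
    unfolding imitation_receiver_utility imitation_decision_schemes x right_diff_distrib by simp
  moreover have "0 \<le> (3 / 4 - x) * \<psi> 1"
    using x p by simp
  ultimately have separating: "(3 / 4 - x) * \<psi> 1 = 0"
    by simp
  \<comment> \<open>The sender does not gain by deviating to full imitation; the contribution of
    state 0 cancels.\<close>
  have "3 / 4 * \<psi> 0 \<le> x * \<psi> 0 + (3 / 4 - x) * \<psi> 1"
    using bs[of "\<lambda>(\<theta>, \<sigma>). if \<theta> = 0 then 1 / 4 else if \<sigma> = 0 then 3 / 4 else 0"]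
    by (simp add: imitation_sender_utility imitation_signaling_schemes x del: One_nat_def)
  then have "(3 / 4 - x) * \<psi> 0 \<le> 0"
    using separating unfolding left_diff_distrib by linarith
  moreover have "0 \<le> (3 / 4 - x) * \<psi> 0"
    using x p by simp
  ultimately have pooling: "x = 3 / 4 \<or> \<psi> 0 = 0"
    by auto
  \<comment> \<open>The receiver does not gain by rejecting signal 0. Under full imitation the
    factor is 1/2, which forces \<open>\<psi> 0 = 0\<close>.\<close>
  have "(x - 1 / 4) * \<psi> 0 \<le> 0"
    using br[of "\<psi>(0 := 0)"] \<psi>
    by (simp add: imitation_receiver_utility imitation_decision_schemes x algebra_simps del: One_nat_def)
  then have "\<psi> 0 = 0"
    using pooling p by (auto simp: mult_le_0_iff)
  then show ?thesis
    using separating by (simp add: imitation_sender_utility x del: One_nat_def)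
qed

text \<open>Without an equilibrium the worst and best utilities would be \<infinity> and
  -\<infinity> instead of 0. Full imitation with universal rejection works: the sender is
  indifferent, and rejecting signal 0 is optimal by 3/4 against 1/4.\<close>

lemma imitation_equilibria_nonempty: "equilibria imitation_game \<noteq> {}"
proof -
  have "(\<lambda>(\<theta>, \<sigma>). if \<theta> = 0 then 1 / 4 else if \<sigma> = 0 then 3 / 4 else 0, \<lambda>_. 0)
      \<in> equilibria imitation_game"
    by (auto simp: equilibria_def sender_best_responses_def receiver_best_responses_def
        imitation_receiver_utility imitation_sender_utility imitation_signaling_schemes
        imitation_decision_schemes field_simps)
  then show ?thesis by blast
qed

lemma imitation_equilibrium_values:
  "worst_equilibrium_utility imitation_game Sender = 0"
  "best_equilibrium_utility imitation_game Sender = 0"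
proof -
  have "(\<lambda>(\<phi>, \<psi>). ereal (expected_utility imitation_game Sender \<phi> \<psi>)) ` equilibria imitation_game
      = {0}"
    using imitation_equilibria_nonempty
    by (force simp: imitation_equilibrium_utility image_iff zero_ereal_def)
  then show "worst_equilibrium_utility imitation_game Sender = 0"
    "best_equilibrium_utility imitation_game Sender = 0"
    by (simp_all add: worst_equilibrium_utility_def best_equilibrium_utility_def)
qed

lemma imitation_commitment_pos: "0 < commitment_utility imitation_game Sender"
proof -
  define \<phi> :: "nat \<times> nat \<Rightarrow> real"
    \<comment> \<open>The imitating mass 1/8 lies strictly below the threshold 1/4, so accepting
      signal 0 is strictly optimal and no tie has to be broken.\<close>
    where "\<phi> = (\<lambda>(\<theta>, \<sigma>). if \<theta> = 0 then 1 / 4 else if \<sigma> = 0 then 1 / 8 else 5 / 8)"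
  define \<psi> :: "nat \<Rightarrow> real" where "\<psi> \<sigma> = (if \<sigma> = 0 then 1 else 0)" for \<sigma>
  have \<phi>: "\<phi> \<in> signaling_schemes imitation_game"
    by (simp add: imitation_signaling_schemes \<phi>_def)
  have U: "expected_utility imitation_game Receiver \<phi> \<psi>' = 3 / 4 + \<psi>' 0 / 8 - 5 / 8 * \<psi>' 1" for \<psi>'
    by (simp add: imitation_receiver_utility \<phi>_def field_simps)
  have \<psi>: "\<psi> \<in> receiver_best_responses imitation_game \<phi>"
    by (auto simp: receiver_best_responses_def U imitation_decision_schemes \<psi>_def)
  have "\<psi>' \<sigma> \<le> \<psi> \<sigma>"
    if "\<psi>' \<in> receiver_best_responses imitation_game \<phi>" "\<sigma> \<in> signals imitation_game" for \<psi>' \<sigma>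
  proof -
    have d: "0 \<le> \<psi>' 0" "\<psi>' 0 \<le> 1" "0 \<le> \<psi>' 1" "\<psi> \<in> decision_schemes imitation_game"
      using that \<psi> by (auto simp: receiver_best_responses_def imitation_decision_schemes)
    \<comment> \<open>The left side is the receiver's utility from \<open>\<psi>\<close>. As
      \<open>\<psi>' 0 \<le> 1\<close>, a best response can reach it only by rejecting signal
      1.\<close>
    then have "3 / 4 + 1 / 8 \<le> 3 / 4 + \<psi>' 0 / 8 - 5 / 8 * \<psi>' 1"
      using that(1) unfolding receiver_best_responses_def U by (force simp: \<psi>_def)
    then have "\<psi>' 1 \<le> 0"
      using d by linarith
    then show ?thesis
      using that(2) d by (auto simp: \<psi>_def)
  qed
  then have "(\<phi>, \<psi>) \<in> commitment_profiles imitation_game Sender"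
    using \<phi> \<psi> by (auto simp: accepting_best_responses_def)
  moreover have "expected_utility imitation_game Sender \<phi> \<psi> = 3 / 8"
    by (simp add: imitation_sender_utility \<phi>_def \<psi>_def)
  ultimately have "ereal (3 / 8) \<le> commitment_utility imitation_game Sender"
    unfolding commitment_utility_def by (intro SUP_upper2[of "(\<phi>, \<psi>)"]) auto
  then show ?thesis
    by (rule less_le_trans[rotated]) simp
qed

lemma imitation_sender_prices:
  "price_of_anarchy imitation_game Sender = \<infinity>" "price_of_stability imitation_game Sender = \<infinity>"
  using imitation_commitment_pos
  by (simp_all add: price_of_anarchy_def price_of_stability_def imitation_equilibrium_values
      divide_ereal_def)

theorem proposition3p2:
  shows "(\<forall>G :: ('s, 'm) evidence_game. evidence_game G \<longrightarrow> price_of_anarchy G Receiver \<le> 2) \<and>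
    (\<exists>G :: (nat, nat) evidence_game. evidence_game G \<and> price_of_anarchy G Receiver = 2) \<and>
    (\<forall>C::real. C > 0 \<longrightarrow>
       (\<exists>G :: (nat, nat) evidence_game. evidence_game G \<and> price_of_anarchy G Sender > ereal C)) \<and>
    (\<forall>C::real. C > 0 \<longrightarrow>
       (\<exists>G :: (nat, nat) evidence_game. evidence_game G \<and> price_of_stability G Sender > ereal C))"
proof (intro conjI allI impI)
  show "price_of_anarchy G Receiver \<le> 2" if "evidence_game G" for G :: "('s, 'm) evidence_game"
    using that by (rule price_of_anarchy_Receiver_le_2)
  show "\<exists>G :: (nat, nat) evidence_game. evidence_game G \<and> price_of_anarchy G Receiver = 2"
    using evidence_game_separable price_of_anarchy_separable by blast
  show "\<exists>G :: (nat, nat) evidence_game. evidence_game G \<and> price_of_anarchy G Sender > ereal C"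
    and "\<exists>G :: (nat, nat) evidence_game. evidence_game G \<and> price_of_stability G Sender > ereal C"
    for C :: real
    by (rule exI[of _ imitation_game], simp add: evidence_game_imitation imitation_sender_prices)+
qed

end
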